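(* Let $\mathscr O_2$ be a finite local principal ideal ring of length two whose residue field $k$ has characteristic $p$, an odd prime. Let $L>0$ be an integer coprime to $p$. Let $A\in\mathrm{GL}_n(\mathscr O_2)$ be a compatible cyclic element, with characteristic polynomial $\chi_{\mathscr O_2,A}(t)=\det(tI-A)\in\mathscr O_2[t]$. Then there exists $B\in\mathrm{GL}_n(\mathscr O_2)$ with $B^L=A$ if and only if each (monic) fundamental irreducible factor of $\chi_{\mathscr O_2,A}(t)$ is an $L$-power polynomial.
   Context: Let $\mathfrak m$ be the maximal ideal of $\mathscr O_2$ and $k=\mathscr O_2/\mathfrak m$. An overline denotes reduction modulo $\mathfrak m$ of ring elements, polynomials and matrices. A polynomial $F\in\mathscr O_2[t]$ is fundamental irreducible if $\overline F$ is irreducible in $k[t]$. A matrix $A\in\mathrm{GL}_n(\mathscr O_2)$ is cyclic if $\overline A\in\mathrm{GL}_n(k)$ is cyclic, i.e. the characteristic and minimal polynomials of $\overline A$ over $k$ coincide. A cyclic $A$ is compatible cyclic if $\chi_{\mathscr O_2,A}(t)=\prod_{i=1}^{\ell}F_i(t)^{r_i}$ with $r_i\ge 1$, where the $F_i\in\mathscr O_2[t]$ are monic fundamental irreducible and $\langle F_i,F_j\rangle=\mathscr O_2[t]$ for $i\ne j$ (so that $\chi_{k,\overline A}(t)=\prod_{i=1}^{\ell}\overline{F_i}(t)^{r_i}$). A monic fundamental irreducible polynomial $F(t)\in\mathscr O_2[t]$ of degree $d$ is an $L$-power polynomial if $F(t^L)$ has a monic fundamental irreducible factor $G(t)\in\mathscr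 O_2[t]$ of degree $d$. *)

theory Defs
  imports "Jordan_Normal_Form.Char_Poly"
begin

context comm_ring_1
begin

definition ring_ideal :: "'a set \<Rightarrow> bool" where
  "ring_ideal I \<longleftrightarrow> 0 \<in> I \<and> (\<forall>x\<in>I. \<forall>y\<in>I. x + y \<in> I) \<and> (\<forall>r. \<forall>x\<in>I. r * x \<in> I)"

definition max_ideal :: "'a set \<Rightarrow> bool" where
  "max_ideal M \<longleftrightarrow> ring_ideal M \<and> M \<noteq> UNIV \<and>
     (\<forall>J. ring_ideal J \<and> M \<subseteq> J \<longrightarrow> J = M \<or> J = UNIV)"

text \<open>A strictly increasing chain \<open>I 0 \<subset> \<dots> \<subset> I m\<close> of ideals; its length is \<open>m\<close>, the number of
  inclusions.\<close>

definition ideal_chain :: "nat \<Rightarrow> (nat \<Rightarrow> 'a set) \<Rightarrow> bool" where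
  "ideal_chain m I \<longleftrightarrow> (\<forall>i\<le>m. ring_ideal (I i)) \<and> (\<forall>i<m. I i \<subset> I (Suc i))"

end

class loc_ring = comm_ring_1 +
  assumes unique_max_ideal: "\<exists>!M. max_ideal M"
begin

definition the_max_ideal :: "'a set" where
  "the_max_ideal = (THE M. max_ideal M)"

lemma max_ideal_the_max_ideal: "max_ideal the_max_ideal"
  unfolding the_max_ideal_def by (rule theI'[OF unique_max_ideal])

end

text \<open>The length of a ring as a module over itself is the supremum of the lengths of its chains of
  ideals; the last two axioms say that it equals two.\<close>

class finite_local_pir_length_two = loc_ring + finite +
  assumes all_ideals_principal: "ring_ideal I \<Longrightarrow> \<exists>a. I = {r * a | r. True}"
    and ideal_chain_length_two: "\<exists>J. ideal_chain 2 J"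
    and ideal_chain_length_le_two: "ideal_chain m J \<Longrightarrow> m \<le> 2"

lemma the_max_ideal_simps:
  fixes x y r :: "'a::loc_ring"
  shows zero_in_the_max_ideal: "0 \<in> (the_max_ideal :: 'a set)"
    and add_in_the_max_ideal:
      "x \<in> the_max_ideal \<Longrightarrow> y \<in> the_max_ideal \<Longrightarrow> x + y \<in> the_max_ideal"
    and mult_in_the_max_ideal: "x \<in> the_max_ideal \<Longrightarrow> r * x \<in> the_max_ideal"
  using max_ideal_the_max_ideal[where 'a = 'a] unfolding max_ideal_def ring_ideal_def by auto

lemma uminus_in_the_max_ideal:
  fixes x :: "'a::loc_ring"
  shows "x \<in> the_max_ideal \<Longrightarrow> - x \<in> the_max_ideal"
  using mult_in_the_max_ideal[of x "- 1"] by simp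

lemma diff_in_the_max_ideal:
  fixes x y :: "'a::loc_ring"
  shows "x \<in> the_max_ideal \<Longrightarrow> y \<in> the_max_ideal \<Longrightarrow> x - y \<in> the_max_ideal"
  using add_in_the_max_ideal[of x "- y"] uminus_in_the_max_ideal[of y] by simp

lemma one_notin_the_max_ideal: "(1 :: 'a::loc_ring) \<notin> the_max_ideal"
proof
  assume 1: "(1 :: 'a) \<in> the_max_ideal"
  have "r \<in> the_max_ideal" for r :: 'a
    using mult_in_the_max_ideal[OF 1, of r] by simp
  then show False
    using max_ideal_the_max_ideal[where 'a = 'a] unfolding max_ideal_def by auto
qed

lemma inverse_mod_the_max_ideal:
  fixes x :: "'a::loc_ring"
  assumes "x \<notin> the_max_ideal"
  shows "\<exists>y. x * y - 1 \<in> the_max_ideal"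
proof -
  define J where "J = {m + r * x | m r. m \<in> the_max_ideal}"
  have zero: "0 \<in> J"
    unfolding J_def using zero_in_the_max_ideal by (auto intro!: exI[of _ 0])
  have add: "a + b \<in> J" if a: "a \<in> J" and b: "b \<in> J" for a b
  proof -
    obtain m r where a': "a = m + r * x" "m \<in> the_max_ideal"
      using a unfolding J_def by auto
    obtain m' r' where b': "b = m' + r' * x" "m' \<in> the_max_ideal"
      using b unfolding J_def by auto
    have "a + b = (m + m') + (r + r') * x"
      using a'(1) b'(1) by (simp add: algebra_simps)
    then show ?thesis
      unfolding J_def using add_in_the_max_ideal[OF a'(2) b'(2)] by blast
  qed
  have mult: "c * a \<in> J" if a: "a \<in> J" for a c
  proof -
    obtain m r where a': "a = m + r * x" "m \<in> the_max_ideal"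
      using a unfolding J_def by auto
    have "c * a = c * m + (c * r) * x"
      using a'(1) by (simp add: algebra_simps)
    then show ?thesis
      unfolding J_def using mult_in_the_max_ideal[OF a'(2), of c] by blast
  qed
  have "ring_ideal J"
    using zero add mult unfolding ring_ideal_def by blast
  moreover have "the_max_ideal \<subseteq> J"
  proof
    fix m :: 'a assume "m \<in> the_max_ideal"
    moreover have "m = m + 0 * x" by simp
    ultimately show "m \<in> J" unfolding J_def by blast
  qed
  moreover have "J \<noteq> the_max_ideal"
  proof -
    have "x = 0 + 1 * x" by simp
    then have "x \<in> J" unfolding J_def using zero_in_the_max_ideal by blast
    then show ?thesis using assms by auto
  qed
  ultimately have "J = UNIV"
    using max_ideal_the_max_ideal[where 'a = 'a] unfolding max_ideal_def by blast
  then have "1 \<in> J" by simp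
  then obtain m r where m: "1 = m + r * x" "m \<in> the_max_ideal"
    unfolding J_def by auto
  have "x * r - 1 = - m"
    using m(1) by (simp add: algebra_simps)
  then show ?thesis
    using uminus_in_the_max_ideal[OF m(2)] by metis
qed

quotient_type (overloaded) 'a residue_field =
    "'a::loc_ring" / "\<lambda>x y. x - y \<in> the_max_ideal"
  morphisms rep_residue reduce
proof (rule equivpI)
  show "reflp (\<lambda>x y :: 'a. x - y \<in> the_max_ideal)"
    by (rule reflpI) (simp add: zero_in_the_max_ideal)
  show "symp (\<lambda>x y :: 'a. x - y \<in> the_max_ideal)"
  proof (rule sympI)
    fix x y :: 'a assume "x - y \<in> the_max_ideal"
    from uminus_in_the_max_ideal[OF this] show "y - x \<in> the_max_ideal" by simp
  qed
  show "transp (\<lambda>x y :: 'a. x - y \<in> the_max_ideal)"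
  proof (rule transpI)
    fix x y z :: 'a assume "x - y \<in> the_max_ideal" "y - z \<in> the_max_ideal"
    from add_in_the_max_ideal[OF this] show "x - z \<in> the_max_ideal" by simp
  qed
qed

instantiation residue_field :: (loc_ring) comm_ring_1
begin

lift_definition zero_residue_field :: "'a residue_field" is 0 .

lift_definition one_residue_field :: "'a residue_field" is 1 .

lift_definition plus_residue_field ::
    "'a residue_field \<Rightarrow> 'a residue_field \<Rightarrow> 'a residue_field" is "(+)"
proof -
  fix a b c d :: 'a assume "a - b \<in> the_max_ideal" "c - d \<in> the_max_ideal"
  from add_in_the_max_ideal[OF this] show "a + c - (b + d) \<in> the_max_ideal"
    by (simp add: algebra_simps)
qed

lift_definition minus_residue_field ::
    "'a residue_field \<Rightarrow> 'a residue_field \<Rightarrow> 'a residue_field" is "(-)"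
proof -
  fix a b c d :: 'a assume "a - b \<in> the_max_ideal" "c - d \<in> the_max_ideal"
  from diff_in_the_max_ideal[OF this] show "a - c - (b - d) \<in> the_max_ideal"
    by (simp add: algebra_simps)
qed

lift_definition uminus_residue_field :: "'a residue_field \<Rightarrow> 'a residue_field" is uminus
proof -
  fix a b :: 'a assume "a - b \<in> the_max_ideal"
  from uminus_in_the_max_ideal[OF this] show "- a - - b \<in> the_max_ideal"
    by (simp add: algebra_simps)
qed

lift_definition times_residue_field ::
    "'a residue_field \<Rightarrow> 'a residue_field \<Rightarrow> 'a residue_field" is "(*)"
proof -
  fix a b c d :: 'a assume "a - b \<in> the_max_ideal" "c - d \<in> the_max_ideal"
  from add_in_the_max_ideal[OF mult_in_the_max_ideal[OF this(1), of c]
      mult_in_the_max_ideal[OF this(2), of b]]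
  show "a * c - b * d \<in> the_max_ideal"
    by (simp add: algebra_simps)
qed

instance
proof
  fix a b c :: "'a residue_field"
  show "a + b + c = a + (b + c)" "a + b = b + a" "0 + a = a" "- a + a = 0" "a - b = a + - b"
    "a * b * c = a * (b * c)" "a * b = b * a" "1 * a = a" "(a + b) * c = a * c + b * c"
    by (transfer; simp add: algebra_simps zero_in_the_max_ideal)+
  show "(0 :: 'a residue_field) \<noteq> 1"
  proof (transfer, rule notI)
    assume "(0 :: 'a) - 1 \<in> the_max_ideal"
    from uminus_in_the_max_ideal[OF this] show False
      by (simp add: one_notin_the_max_ideal)
  qed
qed

end

lemma residue_field_right_inverse:
  fixes x :: "'a::loc_ring residue_field"
  shows "x \<noteq> 0 \<Longrightarrow> \<exists>y. x * y = 1"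
  by transfer (simp add: inverse_mod_the_max_ideal)

instantiation residue_field :: (loc_ring) field
begin

definition inverse_residue_field :: "'a residue_field \<Rightarrow> 'a residue_field" where
  "inverse_residue_field x = (if x = 0 then 0 else (SOME y. x * y = 1))"

definition divide_residue_field ::
    "'a residue_field \<Rightarrow> 'a residue_field \<Rightarrow> 'a residue_field" where
  "divide_residue_field x y = x * inverse y"

instance
proof
  fix a b :: "'a residue_field"
  show "inverse a * a = 1" if "a \<noteq> 0"
    using someI_ex[OF residue_field_right_inverse[OF that]] that
    by (simp add: inverse_residue_field_def mult.commute)
  show "a div b = a * inverse b"
    by (rule divide_residue_field_def)
  show "inverse (0 :: 'a residue_field) = 0"
    by (simp add: inverse_residue_field_def)
qed

end

lemma reduce_comm_ring_hom: "comm_ring_hom (reduce :: 'a::loc_ring \<Rightarrow> 'a residue_field)"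
  by unfold_locales
    (simp_all add: zero_residue_field.abs_eq one_residue_field.abs_eq
      plus_residue_field.abs_eq times_residue_field.abs_eq)

lemma reduce_surj: "\<exists>r. reduce r = x"
  by (metis Quotient3_abs_rep Quotient3_residue_field)

lemma reduce_eq_0_iff: "reduce x = 0 \<longleftrightarrow> x \<in> the_max_ideal"
  by (simp add: zero_residue_field_def residue_field.abs_eq_iff)

definition GL :: "nat \<Rightarrow> 'a::comm_ring_1 mat set" where
  "GL n = {A \<in> carrier_mat n n. invertible_mat A}"

text \<open>The value \<open>\<Sum>k. coeff f k \<cdot> A ^ k\<close> of a polynomial at a square matrix, entry by entry.\<close>

definition poly_at_mat :: "'a::comm_ring_1 poly \<Rightarrow> 'a mat \<Rightarrow> 'a mat" where
  "poly_at_mat f A =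
     mat (dim_row A) (dim_row A) (\<lambda>(i, j). \<Sum>k\<le>degree f. coeff f k * (A ^\<^sub>m k) $$ (i, j))"

definition annihilates :: "'a::comm_ring_1 poly \<Rightarrow> 'a mat \<Rightarrow> bool" where
  "annihilates f A \<longleftrightarrow> poly_at_mat f A = 0\<^sub>m (dim_row A) (dim_row A)"

definition is_minimal_poly :: "'a::field poly \<Rightarrow> 'a mat \<Rightarrow> bool" where
  "is_minimal_poly f A \<longleftrightarrow> lead_coeff f = 1 \<and> annihilates f A \<and>
     (\<forall>g. g \<noteq> 0 \<and> annihilates g A \<longrightarrow> degree f \<le> degree g)"

definition cyclic_mat :: "'a::loc_ring mat \<Rightarrow> bool" where
  "cyclic_mat A \<longleftrightarrow> is_minimal_poly (char_poly (map_mat reduce A)) (map_mat reduce A)"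

definition fundamental_irreducible :: "'a::loc_ring poly \<Rightarrow> bool" where
  "fundamental_irreducible F \<longleftrightarrow> irreducible (map_poly reduce F)"

definition compatible_cyclic :: "'a::loc_ring mat \<Rightarrow> bool" where
  "compatible_cyclic A \<longleftrightarrow> cyclic_mat A \<and>
     (\<exists>(l :: nat) F r. char_poly A = (\<Prod>i<l. F i ^ r i) \<and>
        (\<forall>i<l. r i \<ge> (1 :: nat) \<and> lead_coeff (F i) = 1 \<and> fundamental_irreducible (F i)) \<and>
        (\<forall>i<l. \<forall>j<l. i \<noteq> j \<longrightarrow> {u * F i + v * F j | u v. True} = UNIV))"

text \<open>\<open>F \<circ>\<^sub>p monom 1 L\<close> is the polynomial \<open>F(t\<^sup>L)\<close>.\<close>

definition L_power_poly :: "nat \<Rightarrow> 'a::loc_ring poly \<Rightarrow> bool" where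
  "L_power_poly L F \<longleftrightarrow> lead_coeff F = 1 \<and> fundamental_irreducible F \<and>
     (\<exists>G. lead_coeff G = 1 \<and> fundamental_irreducible G \<and> G dvd F \<circ>\<^sub>p monom 1 L \<and>
        degree G = degree F)"

end

theory Submission
  imports Defs
begin

text \<open>Write \<open>R\<close> for the ring, \<open>k\<close> for its residue field and \<open>\<chi>\<close> for the characteristic polynomial of \<open>A\<close>.
Both sides of the equivalence are compared with a third condition: the variable \<open>t\<close> is an \<open>L\<close>-th
power modulo a suitable polynomial \<open>P\<close>, written \<open>P dvd [:0, 1:] - h ^ L\<close> throughout.

\<^item> Modulo \<open>\<chi>\<close> this condition gives a matrix root: by the Cayley--Hamilton theorem
  (\<open>cayley_hamilton\<close>), \<open>h(A)\<close> is an \<open>L\<close>-th root of \<open>A\<close>. Conversely, suppose \<open>B ^ L = A\<close> over \<open>k\<close>.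
  As the minimal polynomial of \<open>A\<close> has degree \<open>n\<close>, the algebra \<open>k[A]\<close> has dimension \<open>n\<close>, and it is
  contained in \<open>k[B]\<close>, whose dimension is at most \<open>n\<close>. So \<open>B = h(A)\<close> for some \<open>h\<close>, and then
  \<open>\<chi>\<close> divides \<open>t - h ^ L\<close> over \<open>k\<close> (\<open>cyclic_power_root\<close>).

\<^item> Roots lift from \<open>k\<close> to \<open>R\<close> and from a polynomial to its powers, because \<open>L\<close> is prime to \<open>p\<close>
  (\<open>lift_power_root\<close>). In place of a Newton iteration, the congruence is raised to a high power
  \<open>N\<close> of \<open>p\<close>: this kills the nilpotent error and leaves \<open>t ^ N\<close> an \<open>L\<close>-th power. Since \<open>L\<close> and \<open>N\<close>
  are coprime and, \<open>A\<close> being invertible, \<open>t\<close> is a unit modulo \<open>\<chi>\<close>, also \<open>t\<close> is an \<open>L\<close>-th power.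

\<^item> For a monic fundamental irreducible factor \<open>F\<close> of \<open>\<chi>\<close>, being an \<open>L\<close>-power polynomial means that
  \<open>t\<close> is an \<open>L\<close>-th power modulo \<open>F\<close>; by lifting it is the same over \<open>k\<close> and over \<open>R\<close>. If \<open>G\<close> is fundamental
  irreducible, divides \<open>F(t ^ L)\<close> and has the degree of \<open>F\<close>, then
  \<open>f \<mapsto> f(t ^ L)\<close> maps \<open>k[t]/F\<close> isomorphically to \<open>k[t]/G\<close>, and the preimage of \<open>t\<close> is the
  wanted root (\<open>L_power_poly_imp_root\<close>). In the other direction \<open>G\<close> is the polynomial of degree
  \<open>degree F\<close> that has the root \<open>h\<close> of \<open>t\<close> in \<open>R[t]/F\<close> as a zero (\<open>root_imp_L_power_poly\<close>).

\<^item> The roots modulo the comaximal prime powers \<open>F\<^sub>i ^ r\<^sub>i\<close> combine to one modulo \<open>\<chi>\<close> by the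
  Chinese remainder theorem (\<open>power_root_prod\<close>).

All the dimension arguments are counting arguments: \<open>R\<close> and \<open>k\<close> are finite, and one pigeonhole
lemma on substitutions \<open>f \<mapsto> f(s)\<close> modulo a monic polynomial (\<open>injective_substitution\<close>) serves
each of them.\<close>

section \<open>Polynomials of bounded degree and substitution\<close>

text \<open>The polynomials of degree less than \<open>n\<close>, the zero polynomial included also for \<open>n = 0\<close>; they are
the canonical representatives modulo a monic polynomial of degree \<open>n\<close>.\<close>
definition polys_below :: "nat \<Rightarrow> 'a::zero poly set" where
  "polys_below n = {f. \<forall>i\<ge>n. coeff f i = 0}"

lemma polys_below_iff: "f \<in> polys_below n \<longleftrightarrow> f = 0 \<or> degree f < n"
proof
  assume f: "f \<in> polys_below n"
  show "f = 0 \<or> degree f < n"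
  proof (rule ccontr)
    assume "\<not> ?thesis"
    then have "coeff f (degree f) = 0" "f \<noteq> 0"
      using f by (auto simp: polys_below_def)
    then show False by simp
  qed
qed (auto simp: polys_below_def coeff_eq_0)

lemma polys_below_Suc:
  "polys_below (Suc n) = (\<lambda>(a, f). pCons a f) ` (UNIV \<times> polys_below n)"
proof (intro equalityI subsetI)
  fix f :: "'a poly" assume f: "f \<in> polys_below (Suc n)"
  obtain a g where g: "f = pCons a g" by (cases f)
  have "g \<in> polys_below n"
    unfolding polys_below_def
  proof (intro CollectI allI impI)
    fix i assume "n \<le> i"
    then have "coeff f (Suc i) = 0" using f by (simp add: polys_below_def)
    then show "coeff g i = 0" by (simp add: g)
  qed
  then show "f \<in> (\<lambda>(a, f). pCons a f) ` (UNIV \<times> polys_below n)"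
    using g by auto
qed (auto simp: polys_below_def coeff_pCons split: nat.splits)

lemma finite_card_polys_below:
  "finite (polys_below n :: 'a::{zero,finite} poly set)
   \<and> card (polys_below n :: 'a poly set) = card (UNIV :: 'a set) ^ n"
proof (induction n)
  case 0
  have "polys_below 0 = {0 :: 'a poly}"
    by (auto simp: polys_below_iff)
  then show ?case by simp
next
  case (Suc n)
  have "inj_on (\<lambda>(a :: 'a, f). pCons a f) (UNIV \<times> polys_below n)"
    by (auto simp: inj_on_def)
  then show ?case
    using Suc by (simp add: polys_below_Suc card_image card_cartesian_product)
qed

lemma monic_division:
  fixes P f :: "'a::comm_ring_1 poly"
  assumes "lead_coeff P = 1"
  shows "\<exists>r\<in>polys_below (degree P). P dvd f - r"
proof -
  have P: "P \<noteq> 0" using assms by auto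
  obtain q r where qr: "pseudo_divmod f P = (q, r)" by fastforce
  have "f - r = P * q"
    using pseudo_divmod(1)[OF P qr] assms by simp
  then have "P dvd f - r" by simp
  moreover have "r \<in> polys_below (degree P)"
    using pseudo_divmod(2)[OF P qr] by (simp add: polys_below_iff)
  ultimately show ?thesis by blast
qed

text \<open>The ring may have zero divisors, so degrees need not add; but the leading coefficient of a multiple
of a monic \<open>P\<close> is that of the cofactor, at position at least \<open>degree P\<close>.\<close>
lemma monic_dvd_polys_below_eq_0:
  fixes P f :: "'a::comm_ring_1 poly"
  assumes "lead_coeff P = 1" "P dvd f" "f \<in> polys_below (degree P)"
  shows "f = 0"
proof -
  obtain q where q: "f = P * q" using assms(2) by auto
  have "coeff f (degree P + degree q) = lead_coeff q"
    using assms(1) by (simp add: q coeff_mult_degree_sum)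
  then have "q = 0"
    using assms(3) by (simp add: polys_below_def)
  then show ?thesis using q by simp
qed

lemma diff_in_polys_below:
  fixes f g :: "'a::comm_ring_1 poly"
  shows "f \<in> polys_below n \<Longrightarrow> g \<in> polys_below n \<Longrightarrow> f - g \<in> polys_below n"
  by (simp add: polys_below_def)

text \<open>The pigeonhole principle behind all comparisons of quotient rings: on representatives, the
substitution \<open>f \<mapsto> f(s)\<close> modulo \<open>P\<close> is a map from a set of \<open>q ^ m\<close> elements to one of
\<open>q ^ degree P\<close> elements, where \<open>q\<close> is the size of the ring. Injectivity bounds \<open>m\<close>, and forces
surjectivity when the two sizes agree.\<close>
lemma injective_substitution:
  fixes P s :: "'a::{comm_ring_1,finite} poly"
  assumes P: "lead_coeff P = 1"
    and inj: "\<And>f. f \<in> polys_below m \<Longrightarrow> P dvd f \<circ>\<^sub>p s \<Longrightarrow> f = 0"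
  shows injective_substitution_degree_le: "m \<le> degree P"
    and injective_substitution_surj:
      "degree P = m \<Longrightarrow> \<exists>f\<in>polys_below m. P dvd g - f \<circ>\<^sub>p s"
proof -
  let ?n = "degree P"
  have "\<exists>r. \<forall>f. r f \<in> polys_below ?n \<and> P dvd f - r f"
    using monic_division[OF P] by metis
  then obtain r where r: "\<And>f. r f \<in> polys_below ?n" "\<And>f. P dvd f - r f"
    by blast
  have same: "P dvd f - g" if "r f = r g" for f g
    using dvd_diff[OF r(2)[of f] r(2)[of g]] that by simp
  \<comment> \<open>choosing representatives by \<open>r\<close> turns substitution modulo \<open>P\<close> into a map of finite sets\<close>
  have inj_r: "inj_on (\<lambda>f. r (f \<circ>\<^sub>p s)) (polys_below m)"
  proof (rule inj_onI)
    fix f g assume fg: "f \<in> polys_below m" "g \<in> polys_below m" "r (f \<circ>\<^sub>p s) = r (g \<circ>\<^sub>p s)"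
    have "P dvd (f - g) \<circ>\<^sub>p s"
      using same[OF fg(3)] by (simp add: pcompose_diff)
    then show "f = g"
      using inj[OF diff_in_polys_below[OF fg(1,2)]] by simp
  qed
  have img: "(\<lambda>f. r (f \<circ>\<^sub>p s)) ` polys_below m \<subseteq> polys_below ?n"
    using r(1) by auto
  have "card (UNIV :: 'a set) ^ m \<le> card (UNIV :: 'a set) ^ ?n"
    using card_inj_on_le[OF inj_r img] finite_card_polys_below[where 'a='a] by metis
  moreover have "1 < card (UNIV :: 'a set)"
    using card_mono[of UNIV "{0, 1 :: 'a}"] by simp
  ultimately show "m \<le> ?n"
    using power_le_imp_le_exp by blast
  assume m: "?n = m"
  have "(\<lambda>f. r (f \<circ>\<^sub>p s)) ` polys_below m = polys_below m"
    using endo_inj_surj[OF _ _ inj_r] img m finite_card_polys_below[where 'a='a] by auto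
  then have "r g \<in> (\<lambda>f. r (f \<circ>\<^sub>p s)) ` polys_below m"
    using r(1)[of g] m by simp
  then obtain f where f: "f \<in> polys_below m" "r g = r (f \<circ>\<^sub>p s)" by auto
  then show "\<exists>f\<in>polys_below m. P dvd g - f \<circ>\<^sub>p s"
    using same by auto
qed

lemma pcompose_power:
  fixes p q :: "'a::comm_semiring_1 poly"
  shows "(p ^ n) \<circ>\<^sub>p q = (p \<circ>\<^sub>p q) ^ n"
  by (induction n) (simp_all add: pcompose_mult pcompose_1)

lemma monom_1_eq_power: "monom 1 n = ([:0, 1:] :: 'a::comm_semiring_1 poly) ^ n"
  by (simp add: monom_altdef)

lemma pcompose_X [simp]: "[:0, 1:] \<circ>\<^sub>p q = (q :: 'a::comm_semiring_1 poly)"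
  by (simp add: pcompose_pCons)

lemma pcompose_monom_1: "monom 1 n \<circ>\<^sub>p q = (q :: 'a::comm_semiring_1 poly) ^ n"
  by (simp add: monom_1_eq_power pcompose_power)

lemma dvd_diff_trans:
  fixes x :: "'a::comm_ring_1"
  shows "P dvd x - y \<Longrightarrow> P dvd y - z \<Longrightarrow> P dvd x - z"
  using dvd_add[of P "x - y" "y - z"] by simp

lemma dvd_diff_sym:
  fixes x :: "'a::comm_ring_1"
  shows "P dvd x - y \<Longrightarrow> P dvd y - x"
  using dvd_minus_iff[of P "x - y"] by simp

lemma dvd_iff_of_dvd_diff:
  fixes x :: "'a::comm_ring_1"
  assumes "P dvd x - y"
  shows "P dvd x \<longleftrightarrow> P dvd y"
  using dvd_diff[OF _ assms, of x] dvd_add[OF _ assms, of y] by auto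

lemma dvd_diff_mult:
  fixes x :: "'a::comm_ring_1"
  assumes "P dvd x - y" "P dvd u - v"
  shows "P dvd x * u - y * v"
proof -
  have "x * u - y * v = (x - y) * u + y * (u - v)" by (simp add: algebra_simps)
  then show ?thesis using assms by simp
qed

lemma dvd_diff_power:
  fixes x :: "'a::comm_ring_1"
  shows "P dvd x - y \<Longrightarrow> P dvd x ^ n - y ^ n"
  by (induction n) (auto intro: dvd_diff_mult)

lemma dvd_pcompose_diff:
  fixes f :: "'a::comm_ring_1 poly"
  assumes "P dvd x - y"
  shows "P dvd f \<circ>\<^sub>p x - f \<circ>\<^sub>p y"
proof (induction f)
  case (pCons a f)
  have "P dvd x * (f \<circ>\<^sub>p x) - y * (f \<circ>\<^sub>p y)"
    using assms pCons.IH by (rule dvd_diff_mult)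
  then show ?case by (simp add: pcompose_pCons)
qed simp

lemma dvd_pcompose:
  fixes P f s :: "'a::comm_ring_1 poly"
  shows "P dvd f \<Longrightarrow> P \<circ>\<^sub>p s dvd f \<circ>\<^sub>p s"
  by (auto simp: pcompose_mult elim!: dvdE)

text \<open>Where \<open>t = h ^ L\<close>, substituting \<open>h\<close> undoes the substitution of \<open>t ^ L\<close>. So the two substitutions
are homomorphisms in opposite directions between quotients of the polynomial ring.\<close>
lemma dvd_substitute_power:
  fixes f h P :: "'a::comm_ring_1 poly"
  assumes "P dvd [:0, 1:] - h ^ L"
  shows "P dvd (f \<circ>\<^sub>p monom 1 L) \<circ>\<^sub>p h - f"
proof -
  have "(f \<circ>\<^sub>p monom 1 L) \<circ>\<^sub>p h = f \<circ>\<^sub>p h ^ L"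
    by (simp flip: pcompose_assoc add: pcompose_monom_1)
  then show ?thesis
    using dvd_pcompose_diff[OF dvd_diff_sym[OF assms], of f] by simp
qed

lemma pcompose_root_dvd:
  fixes F f g s :: "'a::comm_ring_1 poly"
  assumes "F dvd g \<circ>\<^sub>p s" "g dvd f"
  shows "F dvd f \<circ>\<^sub>p s"
  using assms dvd_pcompose dvd_trans by blast

section \<open>Roots of the variable over a finite field\<close>

text \<open>An \<open>L\<close>-th root \<open>h\<close> of \<open>t\<close> modulo \<open>F\<close> generates the whole quotient by \<open>F\<close>, as \<open>t\<close> does; so it
satisfies no polynomial \<open>g\<close> of smaller degree. Formally, \<open>f \<mapsto> f(t ^ L)\<close> embeds the quotient by \<open>F\<close>
into the quotient by \<open>g\<close>, since substituting \<open>h\<close> recovers \<open>f\<close> modulo \<open>F\<close>.\<close>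
lemma root_degree_ge:
  fixes F h g :: "'a::{field,finite} poly"
  assumes root: "F dvd [:0, 1:] - h ^ L" and F: "lead_coeff F = 1"
    and g: "F dvd g \<circ>\<^sub>p h" "g \<noteq> 0"
  shows "degree F \<le> degree g"
proof -
  define G where "G = Polynomial.smult (inverse (lead_coeff g)) g"
  have G: "lead_coeff G = 1" "degree G = degree g"
    using g(2) by (auto simp: G_def)
  have FG: "F dvd G \<circ>\<^sub>p h"
    using g(1) by (simp add: G_def pcompose_smult dvd_smult)
  have "f = 0" if f: "f \<in> polys_below (degree F)" "G dvd f \<circ>\<^sub>p monom 1 L" for f
  proof -
    have "F dvd (f \<circ>\<^sub>p monom 1 L) \<circ>\<^sub>p h"
      using pcompose_root_dvd[OF FG f(2)] .
    then have "F dvd f"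
      using dvd_iff_of_dvd_diff[OF dvd_substitute_power[OF root, of f]] by blast
    then show ?thesis
      by (rule monic_dvd_polys_below_eq_0[OF F _ f(1)])
  qed
  from injective_substitution_degree_le[OF G(1) this]
  show ?thesis unfolding G(2) by blast
qed

lemma irreducible_bezout:
  fixes F f :: "'a::field poly"
  assumes F: "irreducible F" and ndvd: "\<not> F dvd f"
  shows "\<exists>u v. u * F + v * f = 1"
proof -
  \<comment> \<open>a nonzero element \<open>g\<close> of least degree generates the ideal of \<open>F\<close> and \<open>f\<close>\<close>
  define I where "I = {u * F + v * f | u v. True}"
  have I_F: "F \<in> I" and I_f: "f \<in> I"
  proof -
    have "F = 1 * F + 0 * f" "f = 0 * F + 1 * f" by simp_all
    then show "F \<in> I" "f \<in> I" unfolding I_def by blast+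
  qed
  have I_lin: "x - q * y \<in> I" if xy: "x \<in> I" "y \<in> I" for x y q
  proof -
    obtain u v u' v' where "x = u * F + v * f" "y = u' * F + v' * f"
      using xy unfolding I_def by auto
    then have "x - q * y = (u - q * u') * F + (v - q * v') * f"
      by (simp add: algebra_simps)
    then show ?thesis unfolding I_def by blast
  qed
  have F0: "F \<noteq> 0" using F by auto
  obtain g where g: "g \<in> I" "g \<noteq> 0" "\<And>y. y \<in> I \<Longrightarrow> y \<noteq> 0 \<Longrightarrow> degree g \<le> degree y"
    using ex_has_least_nat[of "\<lambda>g. g \<in> I \<and> g \<noteq> 0" F degree] I_F F0 by blast
  have g_dvd: "g dvd x" if "x \<in> I" for x
  proof -
    have "x - (x div g) * g \<in> I" using that g(1) by (rule I_lin)
    then have "x mod g \<in> I" by (simp add: minus_div_mult_eq_mod)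
    moreover have "x mod g = 0 \<or> degree (x mod g) < degree g"
      using degree_mod_less[OF g(2)] by blast
    ultimately have "x mod g = 0" using g(3)[of "x mod g"] by (meson not_le)
    then show ?thesis by (simp add: mod_eq_0_iff_dvd)
  qed
  obtain q where q: "F = g * q" using g_dvd[OF I_F] by (rule dvdE)
  have "\<not> q dvd 1"
  proof
    assume "q dvd 1"
    then have "F dvd g" by (simp only: q mult_unit_dvd_iff dvd_refl)
    then show False using g_dvd[OF I_f] ndvd dvd_trans by blast
  qed
  then have "g dvd 1" using irreducibleD[OF F q] by blast
  then obtain c where c: "1 = g * c" by (rule dvdE)
  obtain u v where "g = u * F + v * f" using g(1) unfolding I_def by auto
  then have "c * u * F + c * v * f = 1"
    unfolding c by (simp add: algebra_simps)
  then show ?thesis by blast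
qed

section \<open>Reduction modulo the maximal ideal\<close>

instance residue_field :: ("{loc_ring, finite}") finite
proof
  have "(UNIV :: 'a residue_field set) = range reduce"
    using reduce_surj by (metis UNIV_eq_I rangeI)
  then show "finite (UNIV :: 'a residue_field set)"
    by (metis finite finite_imageI)
qed

interpretation reduce: comm_ring_hom "reduce :: 'a::loc_ring \<Rightarrow> 'a residue_field"
  by (rule reduce_comm_ring_hom)

interpretation reduce_poly: map_poly_comm_ring_hom "reduce :: 'a::loc_ring \<Rightarrow> 'a residue_field" ..

abbreviation reduce_poly :: "'a::loc_ring poly \<Rightarrow> 'a residue_field poly" where
  "reduce_poly \<equiv> map_poly reduce"

lemma reduce_poly_surj: "\<exists>f. reduce_poly f = g"
proof (induction g)
  case (pCons a g)
  then show ?case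
    by (metis reduce.map_poly_pCons_hom reduce_surj)
qed (auto intro: exI[of _ 0])

lemma reduce_poly_dvd: "P dvd f \<Longrightarrow> reduce_poly P dvd reduce_poly f"
  by (auto simp: hom_distribs elim!: dvdE)

lemma monic_reduce_poly:
  assumes "lead_coeff P = 1"
  shows "degree (reduce_poly P) = degree P" "lead_coeff (reduce_poly P) = 1"
proof -
  show "degree (reduce_poly P) = degree P"
    using assms by (intro degree_map_poly) auto
  then show "lead_coeff (reduce_poly P) = 1"
    using assms by (simp add: coeff_map_poly)
qed

section \<open>Finite local principal ideal rings of length two\<close>

text \<open>A non-unit lies in a proper ideal, and by finiteness in a maximal one, of which there is only one.\<close>
lemma unit_iff_notin_the_max_ideal:
  fixes x :: "'a::{loc_ring, finite}"
  shows "x dvd 1 \<longleftrightarrow> x \<notin> the_max_ideal"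
proof
  assume "x dvd 1"
  then obtain y where "y * x = 1" by (metis dvdE mult.commute)
  then show "x \<notin> the_max_ideal"
    using mult_in_the_max_ideal[of x y] one_notin_the_max_ideal by metis
next
  assume x: "x \<notin> the_max_ideal"
  show "x dvd 1"
  proof (rule ccontr)
    assume nunit: "\<not> x dvd 1"
    define S where "S = {J :: 'a set. ring_ideal J \<and> J \<noteq> UNIV}"
    have "{y. x dvd y} \<in> S"
      using nunit unfolding S_def ring_ideal_def by (auto intro: dvd_mult)
    then obtain J where J: "J \<in> S" "{y. x dvd y} \<subseteq> J" "\<And>K. K \<in> S \<Longrightarrow> J \<subseteq> K \<Longrightarrow> J = K"
      using finite_has_maximal2[OF finite[of S]] by metis
    have "max_ideal J"
      unfolding max_ideal_def using J(1,3) unfolding S_def by blast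
    then have "J = the_max_ideal"
      using unique_max_ideal max_ideal_the_max_ideal by auto
    moreover have "x \<in> J" using J(2) dvd_refl by blast
    ultimately show False using x by simp
  qed
qed

text \<open>If the generator \<open>\<pi>\<close> of the maximal ideal had a nonzero square, then \<open>0\<close>, the ideal of \<open>\<pi> * \<pi>\<close>, the
ideal of \<open>\<pi>\<close> and the ring would form a chain of length three. The middle inclusion is strict because
\<open>\<pi> = \<pi> * \<pi> * c\<close> makes the unit \<open>1 - \<pi> * c\<close> annihilate \<open>\<pi>\<close>.\<close>
lemma uniformizer_exists:
  "\<exists>\<pi> :: 'a::finite_local_pir_length_two. (\<forall>x. reduce x = 0 \<longleftrightarrow> \<pi> dvd x) \<and> \<pi> * \<pi> = 0"
proof -
  have "ring_ideal (the_max_ideal :: 'a set)"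
    using max_ideal_the_max_ideal unfolding max_ideal_def by blast
  from all_ideals_principal[OF this]
  obtain \<pi> :: 'a where "the_max_ideal = {r * \<pi> | r. True}" by blast
  then have max: "the_max_ideal = {x. \<pi> dvd x}"
    by (auto simp: dvd_def mult.commute)
  have "\<pi> * \<pi> = 0"
  proof (rule ccontr)
    assume sq: "\<pi> * \<pi> \<noteq> 0"
    define I where "I i = (if i = 0 then {0} else if i = 1 then {x. \<pi> * \<pi> dvd x}
      else if i = 2 then {x. \<pi> dvd x} else UNIV)" for i :: nat
    have strict: "\<not> \<pi> * \<pi> dvd \<pi>"
    proof
      assume "\<pi> * \<pi> dvd \<pi>"
      then obtain c where "\<pi> = \<pi> * \<pi> * c" by (rule dvdE)
      then have 0: "\<pi> * (1 - \<pi> * c) = 0" by (simp add: algebra_simps)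
      have "1 - \<pi> * c \<notin> the_max_ideal"
      proof
        assume "1 - \<pi> * c \<in> the_max_ideal"
        moreover have "\<pi> * c \<in> the_max_ideal" unfolding max by simp
        ultimately have "(1 - \<pi> * c) + \<pi> * c \<in> the_max_ideal" by (rule add_in_the_max_ideal)
        then show False using one_notin_the_max_ideal[where 'a = 'a] by simp
      qed
      then obtain d where "1 = (1 - \<pi> * c) * d"
        using unit_iff_notin_the_max_ideal by (metis dvdE)
      then have "\<pi> = \<pi> * (1 - \<pi> * c) * d" by (metis mult.assoc mult_1_right)
      then show False using 0 sq by simp
    qed
    have "\<not> \<pi> dvd 1"
      using one_notin_the_max_ideal[where 'a = 'a] unfolding max by simp
    then have "ideal_chain 3 I"
      using sq strict unfolding ideal_chain_def ring_ideal_def I_def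
      by (auto simp: numeral_3_eq_3 less_Suc_eq psubset_eq intro: dvd_mult dvd_mult_left)
    then show False using ideal_chain_length_le_two by fastforce
  qed
  then show ?thesis
    unfolding reduce_eq_0_iff max by blast
qed

lemma reduce_poly_eq_0_imp_smult:
  fixes f :: "'a::loc_ring poly"
  assumes \<pi>: "\<And>x :: 'a. reduce x = 0 \<Longrightarrow> \<pi> dvd x" and f: "reduce_poly f = 0"
    and below: "f \<in> polys_below n"
  shows "\<exists>g\<in>polys_below n. f = Polynomial.smult \<pi> g"
proof -
  have "\<pi> dvd coeff f i" for i
    using f \<pi> by (metis coeff_0 reduce.coeff_map_poly_hom)
  then have "\<forall>i. \<exists>c. coeff f i = \<pi> * c" by (auto elim!: dvdE)
  then obtain c where c: "\<And>i. coeff f i = \<pi> * c i" by metis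
  define g where "g = (\<Sum>i<n. monom (c i) i)"
  have g: "coeff g i = (if i < n then c i else 0)" for i
    unfolding g_def by (simp add: coeff_sum)
  have "f = Polynomial.smult \<pi> g"
    using below c by (intro poly_eqI) (auto simp: g polys_below_def)
  moreover have "g \<in> polys_below n"
    by (simp add: polys_below_def g)
  ultimately show ?thesis by blast
qed

lemma ex_polys_below: "\<exists>n. f \<in> polys_below n"
  by (meson lessI polys_below_iff)

lemma mult_eq_0_of_reduce_poly_eq_0:
  fixes f g :: "'a::finite_local_pir_length_two poly"
  assumes "reduce_poly f = 0" "reduce_poly g = 0"
  shows "f * g = 0"
proof -
  obtain \<pi> :: 'a where \<pi>: "\<And>x. reduce x = 0 \<Longrightarrow> \<pi> dvd x" "\<pi> * \<pi> = 0"
    using uniformizer_exists by blast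
  obtain u v where "f = Polynomial.smult \<pi> u" "g = Polynomial.smult \<pi> v"
    using reduce_poly_eq_0_imp_smult[OF \<pi>(1)] assms ex_polys_below by metis
  then have "f * g = Polynomial.smult (\<pi> * \<pi>) (u * v)"
    by (simp only: mult_smult_left mult_smult_right smult_smult)
  then show ?thesis using \<pi>(2) by simp
qed

text \<open>The analogue of \<open>root_degree_ge\<close> over the ring itself: the powers of \<open>h\<close> below \<open>degree F\<close> are linearly
independent modulo \<open>F\<close>. A relation \<open>r\<close> vanishes over the residue field, so \<open>r = \<pi> r'\<close>. As the quotient
by the monic \<open>F\<close> is free and only multiples of \<open>\<pi>\<close> annihilate a nonzero \<open>\<pi>\<close>, the polynomial \<open>r'\<close> is a relation
over the residue field as well; hence \<open>r' = \<pi> r''\<close> and \<open>r = \<pi> \<pi> r'' = 0\<close>.\<close>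
lemma root_degree_ge_lift:
  fixes F h r :: "'a::finite_local_pir_length_two poly"
  assumes F: "lead_coeff F = 1" and root: "F dvd [:0, 1:] - h ^ L"
    and r: "r \<in> polys_below (degree F)" "F dvd r \<circ>\<^sub>p h"
  shows "r = 0"
proof -
  obtain \<pi> :: 'a where \<pi>: "\<And>x. reduce x = 0 \<longleftrightarrow> \<pi> dvd x" "\<pi> * \<pi> = 0"
    using uniformizer_exists by blast
  have F': "lead_coeff (reduce_poly F) = 1" "degree (reduce_poly F) = degree F"
    using monic_reduce_poly[OF F] by auto
  have "reduce_poly F dvd reduce_poly ([:0, 1:] - h ^ L)"
    using root by (rule reduce_poly_dvd)
  then have root': "reduce_poly F dvd [:0, 1:] - reduce_poly h ^ L"
    by (simp add: hom_distribs)
  have reduced: "reduce_poly f = 0"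
    if f: "f \<in> polys_below (degree F)" "reduce_poly F dvd reduce_poly (f \<circ>\<^sub>p h)" for f
  proof (rule ccontr)
    assume "reduce_poly f \<noteq> 0"
    then have "degree F \<le> degree (reduce_poly f)" "f \<noteq> 0"
      using root_degree_ge[OF root' F'(1), of "reduce_poly f"] f(2) F'(2)
      by (auto simp: hom_distribs)
    moreover have "degree (reduce_poly f) \<le> degree f"
      by (rule degree_map_poly_le)
    ultimately show False
      using f(1) by (auto simp: polys_below_iff)
  qed
  have "reduce_poly r = 0"
    using reduced[OF r(1) reduce_poly_dvd[OF r(2)]] .
  then obtain r' where r': "r' \<in> polys_below (degree F)" "r = Polynomial.smult \<pi> r'"
    using reduce_poly_eq_0_imp_smult[of \<pi> r, OF _ _ r(1)] \<pi>(1) by blast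
  obtain s where s: "s \<in> polys_below (degree F)" "F dvd r' \<circ>\<^sub>p h - s"
    using monic_division[OF F] by blast
  have "F dvd Polynomial.smult \<pi> (r' \<circ>\<^sub>p h) - Polynomial.smult \<pi> (r' \<circ>\<^sub>p h - s)"
    using dvd_diff[OF r(2) dvd_smult[OF s(2)]] by (simp only: r'(2) pcompose_smult)
  then have "F dvd Polynomial.smult \<pi> s"
    by (simp add: smult_diff_right)
  moreover have "Polynomial.smult \<pi> s \<in> polys_below (degree F)"
    using s(1) by (simp add: polys_below_def)
  ultimately have ps: "Polynomial.smult \<pi> s = 0"
    by (rule monic_dvd_polys_below_eq_0[OF F])
  \<comment> \<open>a unit coefficient of \<open>s\<close> would force \<open>\<pi> = 0\<close>, and with it \<open>r = 0\<close>\<close>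
  show ?thesis
  proof (cases "reduce_poly s = 0")
    case True
    then have "reduce_poly F dvd reduce_poly (r' \<circ>\<^sub>p h)"
      using reduce_poly_dvd[OF s(2)] by (simp add: hom_distribs)
    then have "reduce_poly r' = 0" using reduced[OF r'(1)] by simp
    moreover have "reduce_poly [:\<pi>:] = 0"
      using \<pi>(1)[of \<pi>] by (intro poly_eqI) (simp add: coeff_map_poly coeff_pCons split: nat.split)
    ultimately have "[:\<pi>:] * r' = 0" by (intro mult_eq_0_of_reduce_poly_eq_0)
    then show ?thesis by (simp add: r'(2))
  next
    case False
    then obtain i where "reduce (coeff s i) \<noteq> 0"
      by (metis coeff_0 poly_eqI reduce.coeff_map_poly_hom)
    then have "coeff s i dvd 1"
      by (simp add: unit_iff_notin_the_max_ideal reduce_eq_0_iff)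
    then obtain c where c: "1 = coeff s i * c" by (rule dvdE)
    have "\<pi> * coeff s i = 0"
      using arg_cong[OF ps, of "\<lambda>f. coeff f i"] by simp
    then have "\<pi> = 0" using c by (metis mult.assoc mult_1_right mult_zero_left)
    then show ?thesis by (simp add: r'(2))
  qed
qed

section \<open>Lifting roots of the variable\<close>

lemma power_add_square_zero:
  fixes y w :: "'a::comm_ring_1"
  assumes "w * w = 0"
  shows "(y + w) ^ Suc n = y ^ Suc n + of_nat (Suc n) * y ^ n * w"
proof (induction n)
  case (Suc n)
  have "(y + w) ^ Suc (Suc n) = (y + w) * (y ^ Suc n + of_nat (Suc n) * y ^ n * w)"
    using Suc by simp
  also have "\<dots> = y ^ Suc (Suc n) + of_nat (Suc (Suc n)) * y ^ Suc n * w
      + of_nat (Suc n) * y ^ n * (w * w)"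
    by (simp add: algebra_simps)
  finally show ?case using assms by simp
qed simp

text \<open>Over the residue field, the map \<open>f \<mapsto> f ^ q\<close> with \<open>q = p ^ r\<close> is additive. Since \<open>r \<le> q\<close>, it
turns the divisibility into \<open>t ^ q = h ^ (L q)\<close> modulo \<open>P\<close>. Lifted to the ring, this holds up to an
error \<open>w\<close> with coefficients in the maximal ideal. As \<open>p\<close> is in this ideal too, \<open>w * w\<close> and \<open>p w\<close>
vanish, so that taking \<open>p\<close>-th powers removes the error. Thus \<open>t ^ N\<close> with \<open>N = q p\<close>
is an \<open>L\<close>-th power. Write \<open>N b = L a + 1\<close>: then \<open>t = t ^ (N b) * c ^ (L a)\<close> is an \<open>L\<close>-th power,
where \<open>c\<close> is the inverse of \<open>t\<close>, which exists as the constant coefficient of \<open>P\<close> is a unit.\<close>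
lemma lift_power_root:
  fixes P :: "'a::finite_local_pir_length_two poly" and h :: "'a residue_field poly"
  assumes p: "prime p" "CHAR('a residue_field) = p" and L: "coprime L p"
    and root: "reduce_poly P dvd ([:0, 1:] - h ^ L) ^ r" and unit: "coeff P 0 dvd 1"
  shows "\<exists>h. P dvd [:0, 1:] - h ^ L"
proof -
  obtain h0 where h0: "h = reduce_poly h0" using reduce_poly_surj by metis
  define q where "q = p ^ r"
  define y where "y = (h0 ^ L) ^ q"
  let ?X = "[:0, 1:] :: 'a poly"
  have "r \<le> q"
    unfolding q_def using less_exp p(1) prime_ge_2_nat
    by (metis less_imp_le_nat order_trans power_mono zero_le)
  then have "reduce_poly P dvd ([:0, 1:] - h ^ L) ^ q"
    using root le_imp_power_dvd dvd_trans by blast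
  also have "([:0, 1:] - h ^ L) ^ q = reduce_poly (?X ^ q - y)"
  proof -
    have "([:0, 1:] - h ^ L + h ^ L) ^ q = ([:0, 1:] - h ^ L) ^ q + (h ^ L) ^ q"
      by (rule freshmans_dream') (use p in \<open>simp_all add: q_def\<close>)
    then show ?thesis
      by (simp add: hom_distribs y_def h0 del: reduce.map_poly_pCons_hom)
  qed
  finally obtain u where "reduce_poly (?X ^ q - y) = reduce_poly P * u" by (rule dvdE)
  moreover obtain U where "u = reduce_poly U" using reduce_poly_surj by metis
  ultimately have U: "reduce_poly (?X ^ q - y - P * U) = 0" by (simp add: hom_distribs)
  define w where "w = ?X ^ q - y - P * U"
  have w: "w * w = 0" "of_nat p * w = 0"
  proof -
    show "w * w = 0" using mult_eq_0_of_reduce_poly_eq_0 U unfolding w_def by blast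
    have "CHAR('a residue_field poly) = p" using p(2) by simp
    then have "of_nat p = (0 :: 'a residue_field poly)" using of_nat_CHAR by metis
    moreover have "reduce_poly (of_nat p :: 'a poly) = of_nat p" by (simp add: hom_distribs)
    ultimately have "reduce_poly (of_nat p :: 'a poly) = 0" by (rule trans[rotated])
    then show "of_nat p * w = 0" using mult_eq_0_of_reduce_poly_eq_0 U unfolding w_def by blast
  qed
  have "(?X ^ q - P * U) ^ p = y ^ p"
  proof -
    obtain m where m: "p = Suc m" using prime_gt_0_nat[OF p(1)] by (metis gr0_implies_Suc)
    have "(?X ^ q - P * U) ^ p = (y + w) ^ Suc m" by (simp add: w_def m)
    also have "\<dots> = y ^ p + y ^ m * (of_nat p * w)"
      unfolding power_add_square_zero[OF w(1)] m by (simp only: ac_simps)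
    finally show ?thesis using w(2) by simp
  qed
  moreover have "P dvd ?X ^ q - (?X ^ q - P * U)" by simp
  ultimately have frob: "P dvd (?X ^ q) ^ p - y ^ p"
    using dvd_diff_power by metis
  have "coprime (q * p) L" using L by (simp add: q_def coprime_commute)
  moreover have "q * p \<noteq> 0" using p(1) by (simp add: q_def prime_gt_0_nat)
  ultimately obtain b a where ba: "q * p * b = L * a + 1"
    using bezout_nat by (metis coprime_iff_gcd_eq_1)
  obtain c where c: "P dvd c * ?X - 1"
  proof -
    obtain a0 Q where Q: "P = pCons a0 Q" by (cases P)
    obtain e where "1 = a0 * e" using unit unfolding Q coeff_pCons_0 by (rule dvdE)
    then have e: "a0 * e = 1" by (rule sym)
    \<comment> \<open>from \<open>P = a0 + t Q\<close> and \<open>a0 e = 1\<close>\<close>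
    have "(- Polynomial.smult e Q) * ?X - 1 = P * [:- e:]"
      using e by (simp add: Q one_pCons algebra_simps)
    then show ?thesis using that by (metis dvd_triv_left)
  qed
  have frob_b: "P dvd ((?X ^ q) ^ p) ^ b - (y ^ p) ^ b"
    by (rule dvd_diff_power[OF frob])
  have X_power: "((?X ^ q) ^ p) ^ b = ?X ^ (L * a) * ?X"
    by (simp only: ba power_add power_one_right flip: power_mult)
  have "P dvd (c * ?X) ^ (L * a) - 1 ^ (L * a)"
    by (rule dvd_diff_power[OF c])
  from dvd_diff_mult[OF this, of ?X ?X]
  have "P dvd c ^ (L * a) * ((?X ^ q) ^ p) ^ b - ?X"
    by (simp only: X_power power_mult_distrib power_one mult_1_left mult.assoc diff_self dvd_0_right)
  from dvd_diff_trans[OF dvd_diff_sym[OF this] dvd_diff_mult[OF _ frob_b, of "c ^ (L * a)" "c ^ (L * a)"]]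
  have "P dvd ?X - c ^ (L * a) * (y ^ p) ^ b"
    by simp
  also have "c ^ (L * a) * (y ^ p) ^ b = (c ^ a * h0 ^ (q * p * b)) ^ L"
    by (simp add: y_def power_mult_distrib flip: power_mult) (simp add: ac_simps)
  finally have "P dvd ?X - (c ^ a * h0 ^ (q * p * b)) ^ L" .
  then show ?thesis by blast
qed

section \<open>L-power polynomials\<close>

text \<open>Since \<open>F(t ^ L)\<close> vanishes modulo \<open>G\<close>, the map \<open>f \<mapsto> f(t ^ L)\<close> is a homomorphism from the field \<open>k[t]/F\<close>
to \<open>k[t]/G\<close>. It is injective, and the fields have the same size, so some \<open>g\<close> is mapped to \<open>t\<close>. Then
\<open>g ^ L\<close> and \<open>t\<close> have the same image \<open>t ^ L\<close>, hence they agree modulo \<open>F\<close>.\<close>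
lemma L_power_poly_imp_root:
  fixes F :: "'a::{loc_ring, finite} poly"
  assumes "L_power_poly L F"
  shows "\<exists>h. reduce_poly F dvd [:0, 1:] - h ^ L"
proof -
  obtain G where lF: "lead_coeff F = 1" and iF: "irreducible (reduce_poly F)"
    and lG: "lead_coeff G = 1" and iG: "irreducible (reduce_poly G)"
    and G: "G dvd F \<circ>\<^sub>p monom 1 L" "degree G = degree F"
    using assms unfolding L_power_poly_def fundamental_irreducible_def by blast
  let ?F = "reduce_poly F" and ?G = "reduce_poly G"
  have deg: "degree ?F = degree F" "degree ?G = degree F" "lead_coeff ?G = 1"
    using monic_reduce_poly[OF lF] monic_reduce_poly[OF lG] G(2) by simp_all
  have GF: "?G dvd ?F \<circ>\<^sub>p monom 1 L"
    using reduce_poly_dvd[OF G(1)] by (simp add: hom_distribs)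
  have kernel: "?F dvd f" if f: "?G dvd f \<circ>\<^sub>p monom 1 L" for f
  proof (rule ccontr)
    assume "\<not> ?F dvd f"
    then obtain u v where "u * ?F + v * f = 1" using irreducible_bezout[OF iF] by blast
    then have "(u \<circ>\<^sub>p monom 1 L) * (?F \<circ>\<^sub>p monom 1 L) + (v \<circ>\<^sub>p monom 1 L) * (f \<circ>\<^sub>p monom 1 L) = 1"
      by (metis pcompose_1 pcompose_add pcompose_mult)
    then have "?G dvd 1" using GF f by (metis dvd_add dvd_mult)
    then show False using iG irreducible_not_unit by blast
  qed
  have "f = 0" if "f \<in> polys_below (degree F)" "?G dvd f \<circ>\<^sub>p monom 1 L" for f
    using kernel[OF that(2)] that(1) deg(1) dvd_imp_degree_le[of ?F f]
    unfolding polys_below_iff by linarith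
  from injective_substitution_surj[OF deg(3) this deg(2)]
  obtain g where "?G dvd [:0, 1:] - g \<circ>\<^sub>p monom 1 L" by blast
  from dvd_diff_power[OF this, of L]
  have "?G dvd ([:0, 1:] - g ^ L) \<circ>\<^sub>p monom 1 L"
    by (simp only: pcompose_diff pcompose_power pcompose_X pcompose_monom_1 monom_1_eq_power)
  then show ?thesis using kernel by blast
qed

text \<open>By independence and counting, the powers \<open>1, h, \<dots>, h ^ (d - 1)\<close> form a basis of the quotient by \<open>F\<close>,
where \<open>d = degree F\<close>. Writing \<open>h ^ d\<close> in this basis gives a monic \<open>G\<close> of degree \<open>d\<close> with \<open>G(h) = 0\<close>
modulo \<open>F\<close>. As \<open>F(h ^ L) = F(t) = 0\<close>, the remainder of \<open>F(t ^ L)\<close> modulo \<open>G\<close> vanishes at \<open>h\<close>, and is zero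
by independence. Over the residue field, one factor of a factorization of \<open>G\<close> vanishes at \<open>h\<close>, so
that its degree is already \<open>d\<close>.\<close>
lemma root_imp_L_power_poly:
  fixes F :: "'a::finite_local_pir_length_two poly"
  assumes lF: "lead_coeff F = 1" and iF: "fundamental_irreducible F"
    and root: "F dvd [:0, 1:] - h ^ L"
  shows "L_power_poly L F"
proof -
  define d where "d = degree F"
  from injective_substitution_surj[OF lF root_degree_ge_lift[OF lF root] refl]
  obtain r where r: "r \<in> polys_below d" "F dvd monom 1 d \<circ>\<^sub>p h - r \<circ>\<^sub>p h"
    unfolding d_def by blast
  define G where "G = monom 1 d - r"
  have FG: "F dvd G \<circ>\<^sub>p h" using r(2) by (simp add: G_def pcompose_diff)
  have coeff_G: "coeff G d = 1" "\<And>i. i > d \<Longrightarrow> coeff G i = 0"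
    using r(1) by (auto simp: G_def polys_below_def)
  have dG: "degree G = d"
    using coeff_G by (metis degree_le le_antisym le_degree zero_neq_one)
  have lG: "lead_coeff G = 1" using coeff_G(1) dG by simp
  have "G dvd F \<circ>\<^sub>p monom 1 L"
  proof -
    obtain s where s: "s \<in> polys_below d" "G dvd F \<circ>\<^sub>p monom 1 L - s"
      using monic_division[OF lG] dG by blast
    have "F dvd (F \<circ>\<^sub>p monom 1 L) \<circ>\<^sub>p h - s \<circ>\<^sub>p h"
      using pcompose_root_dvd[OF FG s(2)] by (simp add: pcompose_diff)
    moreover have "F dvd (F \<circ>\<^sub>p monom 1 L) \<circ>\<^sub>p h - F"
      using root by (rule dvd_substitute_power)
    ultimately have "F dvd s \<circ>\<^sub>p h"
      using dvd_iff_of_dvd_diff dvd_refl by blast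
    then have "s = 0"
      using root_degree_ge_lift[OF lF root] s(1) d_def by simp
    then show ?thesis using s(2) by simp
  qed
  moreover have "irreducible (reduce_poly G)"
  proof -
    let ?F = "reduce_poly F" and ?G = "reduce_poly G" and ?h = "reduce_poly h"
    have irr: "irreducible ?F" using iF by (simp add: fundamental_irreducible_def)
    have F': "degree ?F = d" "lead_coeff ?F = 1" and G': "degree ?G = d"
      using monic_reduce_poly[OF lF] monic_reduce_poly[OF lG] dG by (simp_all add: d_def)
    have root': "?F dvd [:0, 1:] - ?h ^ L"
      using reduce_poly_dvd[OF root] by (simp add: hom_distribs)
    have "d > 0"
      using irr F'(1) by (metis bot_nat_0.not_eq_extremum irreducible_def is_unit_iff_degree)
    then have G0: "?G \<noteq> 0" "\<not> ?G dvd 1" using G' is_unit_iff_degree[of ?G] by auto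
    have large: "g dvd 1"
      if ab: "?G = f * g" and f: "?F dvd f \<circ>\<^sub>p ?h" for f g
    proof -
      have fg: "f \<noteq> 0" "g \<noteq> 0" using G0(1) ab by auto
      then have "degree f + degree g = d" using G' ab degree_mult_eq by metis
      moreover have "d \<le> degree f" using root_degree_ge[OF root' F'(2) f fg(1)] F'(1) by simp
      ultimately have "degree g = 0" by simp
      then show ?thesis using fg(2) is_unit_iff_degree by blast
    qed
    show ?thesis
    proof (rule irreducibleI[OF G0])
      fix a b assume ab: "?G = a * b"
      have "?F dvd (a \<circ>\<^sub>p ?h) * (b \<circ>\<^sub>p ?h)"
        using reduce_poly_dvd[OF FG] ab by (simp add: hom_distribs pcompose_mult)
      then have "?F dvd a \<circ>\<^sub>p ?h \<or> ?F dvd b \<circ>\<^sub>p ?h"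
        using field_poly_irreducible_imp_prime[OF irr] prime_elem_dvd_mult_iff by blast
      then show "a dvd 1 \<or> b dvd 1"
        using large[OF ab] large[of b a] ab by (auto simp: mult.commute)
    qed
  qed
  ultimately show ?thesis
    unfolding L_power_poly_def fundamental_irreducible_def
    using lF iF[unfolded fundamental_irreducible_def] lG dG d_def by blast
qed

section \<open>Chinese remaindering of roots\<close>

text \<open>The predicate \<open>coprime\<close> is weaker in general: all common divisors may be units without \<open>1\<close> being in
the ideal of \<open>a\<close> and \<open>b\<close>.\<close>
definition comaximal :: "'a::comm_ring_1 \<Rightarrow> 'a \<Rightarrow> bool" where
  "comaximal a b \<longleftrightarrow> (\<exists>u v. u * a + v * b = 1)"

lemma comaximal_sym: "comaximal a b \<Longrightarrow> comaximal b a"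
  unfolding comaximal_def by (metis add.commute)

lemma comaximal_1: "comaximal 1 a"
  unfolding comaximal_def by (metis add.right_neutral mult_1 mult_zero_left)

lemma comaximal_mult:
  assumes "comaximal a c" "comaximal b c"
  shows "comaximal (a * b) c"
proof -
  obtain u v s t where "u * a + v * c = 1" "s * b + t * c = 1"
    using assms unfolding comaximal_def by blast
  then have "(u * a + v * c) * (s * b + t * c) = 1" by simp
  then have "(u * s) * (a * b) + (u * a * t + v * s * b + v * t * c) * c = 1"
    by (simp add: algebra_simps)
  then show ?thesis unfolding comaximal_def by blast
qed

lemma comaximal_power: "comaximal a b \<Longrightarrow> comaximal (a ^ m) b"
  by (induction m) (auto intro: comaximal_1 comaximal_mult)

lemma comaximal_prod: "(\<And>i. i < l \<Longrightarrow> comaximal (f i) b) \<Longrightarrow> comaximal (\<Prod>i<(l::nat). f i) b"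
  by (induction l) (auto intro: comaximal_1 comaximal_mult)

lemma power_root_mult:
  fixes a b x g h :: "'a::comm_ring_1"
  assumes "comaximal a b" and g: "a dvd x - g ^ L" and h: "b dvd x - h ^ L"
  shows "\<exists>k. a * b dvd x - k ^ L"
proof -
  obtain u v where uv: "u * a + v * b = 1" using assms(1) unfolding comaximal_def by blast
  \<comment> \<open>as \<open>v * b\<close> is \<open>1\<close> modulo \<open>a\<close> and \<open>0\<close> modulo \<open>b\<close>, this is \<open>g\<close> modulo \<open>a\<close> and \<open>h\<close> modulo \<open>b\<close>\<close>
  define k where "k = v * b * g + u * a * h"
  have "g - k = a * (u * (g - h)) + (1 - (u * a + v * b)) * g"
    "h - k = b * (v * (h - g)) + (1 - (u * a + v * b)) * h"
    by (simp_all add: k_def algebra_simps)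
  then have "a dvd g - k" "b dvd h - k" by (simp_all add: uv)
  then have "a dvd x - k ^ L" "b dvd x - k ^ L"
    using dvd_diff_trans[OF g dvd_diff_power] dvd_diff_trans[OF h dvd_diff_power] by auto
  then obtain s t where s: "x - k ^ L = a * s" and t: "x - k ^ L = b * t"
    by (auto elim!: dvdE)
  have "x - k ^ L = u * a * (x - k ^ L) + v * b * (x - k ^ L)"
    by (simp add: uv flip: distrib_right)
  also have "\<dots> = u * a * (b * t) + v * b * (a * s)"
    by (metis s t)
  also have "\<dots> = a * b * (u * t + v * s)"
    by (simp add: algebra_simps)
  finally show ?thesis by (metis dvd_triv_left)
qed

lemma power_root_prod:
  fixes P :: "nat \<Rightarrow> 'a::comm_ring_1"
  assumes "\<And>i. i < l \<Longrightarrow> \<exists>h. P i dvd x - h ^ L"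
    and "\<And>i j. i < l \<Longrightarrow> j < l \<Longrightarrow> i \<noteq> j \<Longrightarrow> comaximal (P i) (P j)"
  shows "\<exists>h. (\<Prod>i<l. P i) dvd x - h ^ L"
  using assms
proof (induction l)
  case (Suc l)
  have "\<exists>h. (\<Prod>i<l. P i) dvd x - h ^ L" by (rule Suc.IH) (use Suc.prems in auto)
  moreover have "\<exists>h. P l dvd x - h ^ L" using Suc.prems(1) by simp
  moreover have "comaximal (\<Prod>i<l. P i) (P l)"
    using Suc.prems(2) by (intro comaximal_prod) simp
  ultimately show ?case using power_root_mult by (metis prod.lessThan_Suc)
qed simp

section \<open>Polynomials in a matrix\<close>

lemma poly_at_mat_carrier [simp]:
  "A \<in> carrier_mat n n \<Longrightarrow> poly_at_mat f A \<in> carrier_mat n n"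
  by (auto simp: poly_at_mat_def)

lemma poly_at_mat_dim [simp]:
  "dim_row (poly_at_mat f A) = dim_row A" "dim_col (poly_at_mat f A) = dim_row A"
  by (auto simp: poly_at_mat_def)

lemma poly_at_mat_index:
  assumes "A \<in> carrier_mat n n" "i < n" "j < n" "degree f \<le> N"
  shows "poly_at_mat f A $$ (i, j) = (\<Sum>k\<le>N. coeff f k * (A ^\<^sub>m k) $$ (i, j))"
proof -
  have "(\<Sum>k\<le>degree f. coeff f k * (A ^\<^sub>m k) $$ (i, j)) = (\<Sum>k\<le>N. coeff f k * (A ^\<^sub>m k) $$ (i, j))"
    using assms(4) by (intro sum.mono_neutral_left) (auto simp: coeff_eq_0)
  then show ?thesis
    using assms(1-3) by (simp add: poly_at_mat_def)
qed

lemma poly_at_mat_add: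
  assumes A: "A \<in> carrier_mat n n"
  shows "poly_at_mat (f + g) A = poly_at_mat f A + poly_at_mat g A"
proof (rule eq_matI)
  fix i j assume "i < dim_row (poly_at_mat f A + poly_at_mat g A)"
    "j < dim_col (poly_at_mat f A + poly_at_mat g A)"
  then have ij: "i < n" "j < n" using A by simp_all
  let ?N = "max (degree f) (degree g)"
  show "poly_at_mat (f + g) A $$ (i, j) = (poly_at_mat f A + poly_at_mat g A) $$ (i, j)"
    using A ij poly_at_mat_index[OF A ij, of f ?N] poly_at_mat_index[OF A ij, of g ?N]
      poly_at_mat_index[OF A ij, of "f + g" ?N]
    by (simp add: degree_add_le sum.distrib distrib_right)
qed (use A in auto)

lemma poly_at_mat_smult:
  assumes A: "A \<in> carrier_mat n n"
  shows "poly_at_mat (Polynomial.smult c f) A = c \<cdot>\<^sub>m poly_at_mat f A"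
proof (rule eq_matI)
  fix i j assume "i < dim_row (c \<cdot>\<^sub>m poly_at_mat f A)" "j < dim_col (c \<cdot>\<^sub>m poly_at_mat f A)"
  then have ij: "i < n" "j < n" using A by simp_all
  show "poly_at_mat (Polynomial.smult c f) A $$ (i, j) = (c \<cdot>\<^sub>m poly_at_mat f A) $$ (i, j)"
    using A ij poly_at_mat_index[OF A ij, of f "degree f"]
      poly_at_mat_index[OF A ij, of "Polynomial.smult c f" "degree f"]
    by (simp add: degree_smult_le sum_distrib_left mult.assoc)
qed (use A in auto)

lemma poly_at_mat_pCons:
  assumes A: "A \<in> carrier_mat n n"
  shows "poly_at_mat (pCons a f) A = a \<cdot>\<^sub>m 1\<^sub>m n + poly_at_mat f A * A"
proof (rule eq_matI)
  fix i j assume "i < dim_row (a \<cdot>\<^sub>m 1\<^sub>m n + poly_at_mat f A * A)"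
    "j < dim_col (a \<cdot>\<^sub>m 1\<^sub>m n + poly_at_mat f A * A)"
  then have ij: "i < n" "j < n" using A by simp_all
  have "(poly_at_mat f A * A) $$ (i, j) = (\<Sum>m<n. poly_at_mat f A $$ (i, m) * A $$ (m, j))"
    using A ij by (simp add: scalar_prod_def atLeast0LessThan)
  also have "\<dots> = (\<Sum>m<n. \<Sum>k\<le>degree f. coeff f k * ((A ^\<^sub>m k) $$ (i, m) * A $$ (m, j)))"
    using A ij poly_at_mat_index[OF A ij(1), of _ f "degree f"]
    by (simp add: sum_distrib_right mult.assoc)
  also have "\<dots> = (\<Sum>k\<le>degree f. coeff f k * (\<Sum>m<n. (A ^\<^sub>m k) $$ (i, m) * A $$ (m, j)))"
    by (subst sum.swap) (simp add: sum_distrib_left)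
  also have "\<dots> = (\<Sum>k\<le>degree f. coeff f k * (A ^\<^sub>m Suc k) $$ (i, j))"
    using A ij by (simp add: scalar_prod_def atLeast0LessThan)
  finally have prod: "(poly_at_mat f A * A) $$ (i, j) =
    (\<Sum>k\<le>degree f. coeff f k * (A ^\<^sub>m Suc k) $$ (i, j))" .
  have "poly_at_mat (pCons a f) A $$ (i, j) =
      (\<Sum>k\<le>Suc (degree f). coeff (pCons a f) k * (A ^\<^sub>m k) $$ (i, j))"
    by (rule poly_at_mat_index[OF A ij]) (simp add: degree_pCons_le)
  also have "\<dots> = a * (1\<^sub>m n) $$ (i, j) + (poly_at_mat f A * A) $$ (i, j)"
    unfolding prod using A by (simp add: sum.atMost_Suc_shift del: sum.atMost_Suc)
  finally show "poly_at_mat (pCons a f) A $$ (i, j) = (a \<cdot>\<^sub>m 1\<^sub>m n + poly_at_mat f A * A) $$ (i, j)"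
    using A ij by simp
qed (use A in auto)

lemma poly_at_mat_0: "A \<in> carrier_mat n n \<Longrightarrow> poly_at_mat 0 A = 0\<^sub>m n n"
  by (rule eq_matI) (auto simp: poly_at_mat_def)

lemma poly_at_mat_1: "A \<in> carrier_mat n n \<Longrightarrow> poly_at_mat 1 A = 1\<^sub>m n"
  by (rule eq_matI) (auto simp: poly_at_mat_def)

lemma poly_at_mat_X: "A \<in> carrier_mat n n \<Longrightarrow> poly_at_mat [:0, 1:] A = A"
  by (auto simp: poly_at_mat_pCons poly_at_mat_0 intro!: eq_matI)

lemma poly_at_mat_mult:
  assumes A: "A \<in> carrier_mat n n"
  shows "poly_at_mat (f * g) A = poly_at_mat f A * poly_at_mat g A"
proof (induction g)
  case 0
  then show ?case using A right_mult_zero_mat[OF poly_at_mat_carrier[OF A]] by (simp add: poly_at_mat_0)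
next
  case (pCons a g)
  let ?f = "poly_at_mat f A" and ?g = "poly_at_mat g A"
  have "poly_at_mat (f * pCons a g) A = a \<cdot>\<^sub>m ?f + (0 \<cdot>\<^sub>m 1\<^sub>m n + poly_at_mat (f * g) A * A)"
    using A by (simp only: mult_pCons_right poly_at_mat_add poly_at_mat_smult poly_at_mat_pCons)
  also have "\<dots> = a \<cdot>\<^sub>m ?f + ?f * ?g * A"
    using A by (auto simp: pCons.IH intro!: eq_matI)
  also have "a \<cdot>\<^sub>m ?f = ?f * (a \<cdot>\<^sub>m 1\<^sub>m n)"
    using A by (metis mult_smult_distrib one_carrier_mat poly_at_mat_carrier right_mult_one_mat)
  also have "?f * ?g * A = ?f * (?g * A)"
    using A by (intro assoc_mult_mat[of _ n n _ n _ n]) simp_all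
  also have "?f * (a \<cdot>\<^sub>m 1\<^sub>m n) + ?f * (?g * A) = ?f * (a \<cdot>\<^sub>m 1\<^sub>m n + ?g * A)"
    using A by (intro mult_add_distrib_mat[symmetric, of _ n n _ n]) auto
  also have "a \<cdot>\<^sub>m 1\<^sub>m n + ?g * A = poly_at_mat (pCons a g) A"
    using A by (simp add: poly_at_mat_pCons)
  finally show ?case .
qed

lemma poly_at_mat_power:
  assumes A: "A \<in> carrier_mat n n"
  shows "poly_at_mat (f ^ k) A = poly_at_mat f A ^\<^sub>m k"
proof (induction k)
  case 0
  then show ?case using A by (simp add: poly_at_mat_1)
next
  case (Suc k)
  then show ?case using poly_at_mat_mult[OF A, of "f ^ k" f] by (simp add: mult.commute)
qed

lemma poly_at_mat_pcompose_monom: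
  assumes A: "A \<in> carrier_mat n n"
  shows "poly_at_mat (f \<circ>\<^sub>p monom 1 L) A = poly_at_mat f (A ^\<^sub>m L)"
proof (induction f)
  case 0
  then show ?case using A by (simp add: poly_at_mat_0[of _ n])
next
  case (pCons a f)
  have "pCons a f \<circ>\<^sub>p monom 1 L = Polynomial.smult a 1 + (f \<circ>\<^sub>p monom 1 L) * [:0, 1:] ^ L"
    by (simp add: pcompose_pCons monom_altdef mult.commute)
  then have "poly_at_mat (pCons a f \<circ>\<^sub>p monom 1 L) A =
      a \<cdot>\<^sub>m 1\<^sub>m n + poly_at_mat f (A ^\<^sub>m L) * A ^\<^sub>m L"
    using A pCons.IH by (simp only: poly_at_mat_add poly_at_mat_smult poly_at_mat_1
      poly_at_mat_mult poly_at_mat_power poly_at_mat_X)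
  then show ?case
    using A by (simp add: poly_at_mat_pCons[of _ n])
qed

lemma poly_at_mat_dvd_diff:
  fixes A :: "'a::comm_ring_1 mat"
  assumes A: "A \<in> carrier_mat n n" and P: "poly_at_mat P A = 0\<^sub>m n n" and dvd: "P dvd f - g"
  shows "poly_at_mat f A = poly_at_mat g A"
proof -
  obtain q where "f - g = P * q" using dvd by (rule dvdE)
  then have f: "f = g + P * q" by (simp add: algebra_simps)
  have "poly_at_mat f A = poly_at_mat g A + 0\<^sub>m n n * poly_at_mat q A"
    unfolding f poly_at_mat_add[OF A] poly_at_mat_mult[OF A] P ..
  also have "\<dots> = poly_at_mat g A"
    using A left_mult_zero_mat[OF poly_at_mat_carrier[OF A]]
      right_add_zero_mat[OF poly_at_mat_carrier[OF A]] by simp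
  finally show ?thesis .
qed

lemma poly_at_mat_sum_index:
  assumes A: "A \<in> carrier_mat n n" and ij: "i < n" "j < n"
  shows "poly_at_mat (\<Sum>x\<in>S. f x) A $$ (i, j) = (\<Sum>x\<in>S. poly_at_mat (f x) A $$ (i, j))"
proof (induction S rule: infinite_finite_induct)
  case (insert x S)
  then show ?case using A ij by (simp add: poly_at_mat_add[of _ n])
qed (use A ij in \<open>simp_all add: poly_at_mat_0[of _ n]\<close>)

text \<open>Let a polynomial \<open>f\<close> act on vectors by the matrix \<open>f(A)\<close>, and let \<open>M = t I - A\<close>. In column \<open>i\<close> of \<open>M\<close>,
the sum over \<open>j\<close> of \<open>M\<^sub>j\<^sub>i\<close> applied to the unit vector \<open>e\<^sub>j\<close> is \<open>A e\<^sub>i\<close> minus column \<open>i\<close> of \<open>A\<close>, that is, zero.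
Multiplying by the adjugate of \<open>M\<close> turns these relations into: \<open>det M\<close> applied to \<open>e\<^sub>k\<close> is zero.\<close>
theorem cayley_hamilton:
  fixes A :: "'a::comm_ring_1 mat"
  assumes A: "A \<in> carrier_mat n n"
  shows "poly_at_mat (char_poly A) A = 0\<^sub>m n n"
proof (rule eq_matI)
  fix l k assume "l < dim_row (0\<^sub>m n n :: 'a mat)" "k < dim_col (0\<^sub>m n n :: 'a mat)"
  then have l: "l < n" and k: "k < n" by auto
  define M where "M = char_poly_matrix A"
  \<comment> \<open>\<open>E f i j\<close> is the \<open>i\<close>-th coordinate of \<open>f\<close> applied to \<open>e\<^sub>j\<close>\<close>
  define E where "E f i j = poly_at_mat f A $$ (i, j)" for f i j
  have M: "M \<in> carrier_mat n n" unfolding M_def using A by simp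
  note adj = adj_mat[OF M]
  have E_mult: "E (f * g) i j = (\<Sum>m<n. E f i m * E g m j)" if "i < n" "j < n" for f g i j
    using A that unfolding E_def
    by (simp add: poly_at_mat_mult[OF A] scalar_prod_def atLeast0LessThan)
  have E_M: "E (M $$ (j, i)) m j = (if i = j then A $$ (m, i) else 0) - (if m = j then A $$ (m, i) else 0)"
    if ijm: "i < n" "j < n" "m < n" for i j m
  proof -
    have "M $$ (j, i) = (if i = j then [:0, 1:] else 0) + [:- A $$ (j, i):]"
      unfolding M_def char_poly_matrix_def using A ijm by simp
    then show ?thesis
      unfolding E_def using A ijm
      by (simp add: poly_at_mat_add[OF A] poly_at_mat_X[OF A] poly_at_mat_0[OF A]
        poly_at_mat_pCons[OF A] del: add_pCons)
  qed
  have "E (char_poly A) l k = (\<Sum>j<n. E (if j = k then char_poly A else 0) l j)"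
  proof -
    have "(\<Sum>j<n. E (if j = k then char_poly A else 0) l j) = (\<Sum>j<n. if j = k then E (char_poly A) l j else 0)"
      using A l by (intro sum.cong) (auto simp: E_def poly_at_mat_0[OF A])
    then show ?thesis using k by simp
  qed
  also have "\<dots> = (\<Sum>j<n. E (\<Sum>i<n. adj_mat M $$ (i, k) * M $$ (j, i)) l j)"
  proof (intro sum.cong refl)
    fix j assume "j \<in> {..<n}"
    then have j: "j < n" by simp
    have "(\<Sum>i<n. adj_mat M $$ (i, k) * M $$ (j, i)) = (M * adj_mat M) $$ (j, k)"
      using M adj(1) j k by (simp add: scalar_prod_def atLeast0LessThan mult.commute)
    also have "\<dots> = (if j = k then char_poly A else 0)"
      unfolding adj(2) using j k by (simp add: char_poly_def M_def)
    finally show "E (if j = k then char_poly A else 0) l j =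
        E (\<Sum>i<n. adj_mat M $$ (i, k) * M $$ (j, i)) l j" by simp
  qed
  also have "\<dots> = (\<Sum>j<n. \<Sum>i<n. \<Sum>m<n. E (adj_mat M $$ (i, k)) l m * E (M $$ (j, i)) m j)"
    using l by (intro sum.cong refl) (simp add: E_def poly_at_mat_sum_index[OF A] E_mult[unfolded E_def])
  also have "\<dots> = (\<Sum>i<n. \<Sum>j<n. \<Sum>m<n. E (adj_mat M $$ (i, k)) l m * E (M $$ (j, i)) m j)"
    by (rule sum.swap)
  also have "\<dots> = (\<Sum>i<n. \<Sum>m<n. E (adj_mat M $$ (i, k)) l m * (\<Sum>j<n. E (M $$ (j, i)) m j))"
    unfolding sum_distrib_left by (intro sum.cong refl sum.swap)
  also have "\<dots> = 0"
    by (intro sum.neutral ballI) (simp add: E_M sum_subtractf)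
  finally show "poly_at_mat (char_poly A) A $$ (l, k) = 0\<^sub>m n n $$ (l, k)"
    using l k by (simp add: E_def)
qed (use A in auto)

section \<open>Roots of matrices\<close>

lemma GL_obtain_inverse:
  assumes "A \<in> GL n"
  obtains C where "A \<in> carrier_mat n n" "C \<in> carrier_mat n n" "A * C = 1\<^sub>m n" "C * A = 1\<^sub>m n"
proof -
  have A: "A \<in> carrier_mat n n" using assms by (simp add: GL_def)
  obtain C where C: "A * C = 1\<^sub>m (dim_row A)" "C * A = 1\<^sub>m (dim_row C)"
    using assms unfolding GL_def invertible_mat_def inverts_mat_def by blast
  have "dim_row C = n" using arg_cong[OF C(2), of dim_col] A by simp
  moreover have "dim_col C = n" using arg_cong[OF C(1), of dim_col] A by simp
  ultimately show ?thesis using that[OF A _ _] C A by auto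
qed

lemma GL_of_power_in_GL:
  assumes B: "B \<in> carrier_mat n n" and L: "L > 0" and pow: "B ^\<^sub>m L \<in> GL n"
  shows "B \<in> GL n"
proof -
  obtain C where C: "C \<in> carrier_mat n n" "B ^\<^sub>m L * C = 1\<^sub>m n" "C * B ^\<^sub>m L = 1\<^sub>m n"
    using GL_obtain_inverse[OF pow] by metis
  obtain k where k: "L = Suc k" using L by (cases L) auto
  let ?D = "B ^\<^sub>m k"
  have D: "?D \<in> carrier_mat n n" using B by simp
  have BD: "B * ?D = B ^\<^sub>m L"
  proof -
    have "poly_at_mat ([:0, 1:] * [:0, 1:] ^ k) B = poly_at_mat ([:0, 1:] ^ k * [:0, 1:]) B"
      by (simp only: mult.commute)
    then show ?thesis
      using B by (simp only: poly_at_mat_mult poly_at_mat_power poly_at_mat_X k pow_mat.simps)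
  qed
  have right: "B * (?D * C) = 1\<^sub>m n"
    using B C D BD assoc_mult_mat[OF B D C(1)] by simp
  have left: "C * ?D * B = 1\<^sub>m n"
    using B C D assoc_mult_mat[OF C(1) D B] by (simp add: k)
  define X Y where "X = ?D * C" and "Y = C * ?D"
  have X: "X \<in> carrier_mat n n" "B * X = 1\<^sub>m n" and Y: "Y \<in> carrier_mat n n" "Y * B = 1\<^sub>m n"
    using mult_carrier_mat[OF D C(1)] mult_carrier_mat[OF C(1) D] right left
    by (simp_all only: X_def Y_def)
  have "Y = Y * (B * X)" unfolding X(2) using Y(1) by simp
  also have "\<dots> = Y * B * X" using assoc_mult_mat[OF Y(1) B X(1)] by simp
  also have "\<dots> = X" unfolding Y(2) using X(1) by simp
  finally show ?thesis
    using X Y B unfolding GL_def invertible_mat_def inverts_mat_def by auto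
qed

lemma coeff_0_char_poly_unit:
  assumes "A \<in> GL n"
  shows "coeff (char_poly A) 0 dvd 1"
proof -
  obtain C where C: "A \<in> carrier_mat n n" "C \<in> carrier_mat n n" "A * C = 1\<^sub>m n"
    using GL_obtain_inverse[OF assms] by metis
  have "poly (char_poly A) 0 = det (- A)"
    unfolding char_poly_def
    by (rule poly_det_cong[of _ n]) (use C(1) in \<open>auto simp: char_poly_matrix_def\<close>)
  moreover have "- A * - C = 1\<^sub>m n"
    using C uminus_mult_left_mat[of A "- C"] uminus_mult_right_mat[of A C] by simp
  then have "det (- A) * det (- C) = 1"
    using det_mult[of "- A" n "- C"] C by simp
  ultimately show ?thesis
    unfolding poly_0_coeff_0 by (metis dvd_triv_left)
qed

text \<open>Cyclicity makes \<open>f \<mapsto> f(t ^ L)\<close> injective modulo \<open>char_poly B\<close> on polynomials of degree less than \<open>n\<close>: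
if \<open>f(B ^ L) = f(A)\<close> is zero, then so is \<open>f\<close>. Hence the map is surjective, and a preimage \<open>h\<close> of \<open>t\<close>
satisfies \<open>h(A) = B\<close>. Now \<open>t - h ^ L\<close> annihilates \<open>A\<close>, and so does its remainder modulo
\<open>char_poly A\<close>, which is therefore zero.\<close>
lemma cyclic_power_root:
  fixes A B :: "'a::{field, finite} mat"
  assumes B: "B \<in> carrier_mat n n" and A: "B ^\<^sub>m L = A"
    and cyclic: "is_minimal_poly (char_poly A) A"
  shows "\<exists>h. char_poly A dvd [:0, 1:] - h ^ L"
proof -
  have carrier: "A \<in> carrier_mat n n" using A B by auto
  have deg: "degree (char_poly A) = n" "lead_coeff (char_poly A) = 1"
    "degree (char_poly B) = n" "lead_coeff (char_poly B) = 1"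
    using degree_monic_char_poly[OF carrier] degree_monic_char_poly[OF B] by auto
  have minimal: "f = 0" if "f \<in> polys_below n" "poly_at_mat f A = 0\<^sub>m n n" for f
  proof (rule ccontr)
    assume "f \<noteq> 0"
    moreover have "annihilates f A" using that(2) carrier by (simp add: annihilates_def)
    ultimately have "n \<le> degree f" using cyclic deg(1) unfolding is_minimal_poly_def by blast
    then show False using that(1) \<open>f \<noteq> 0\<close> by (simp add: polys_below_iff)
  qed
  have "f = 0" if f: "f \<in> polys_below n" "char_poly B dvd f \<circ>\<^sub>p monom 1 L" for f
  proof (rule minimal[OF f(1)])
    have "poly_at_mat (f \<circ>\<^sub>p monom 1 L) B = poly_at_mat 0 B"
      using f(2) by (intro poly_at_mat_dvd_diff[OF B cayley_hamilton[OF B]]) simp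
    then show "poly_at_mat f A = 0\<^sub>m n n"
      by (simp only: poly_at_mat_pcompose_monom[OF B] A poly_at_mat_0[OF B])
  qed
  from injective_substitution_surj[OF deg(4) this deg(3)]
  obtain h where h: "char_poly B dvd [:0, 1:] - h \<circ>\<^sub>p monom 1 L" by blast
  from poly_at_mat_dvd_diff[OF B cayley_hamilton[OF B] this]
  have hA: "poly_at_mat h A = B"
    by (simp only: poly_at_mat_pcompose_monom[OF B] A poly_at_mat_X[OF B])
  define k where "k = [:0, 1:] - h ^ L"
  obtain r where r: "r \<in> polys_below n" "char_poly A dvd k - r"
    using monic_division[OF deg(2)] deg(1) by blast
  have "poly_at_mat k A + A = poly_at_mat (k + h ^ L) A"
    by (simp only: poly_at_mat_add[OF carrier] poly_at_mat_power[OF carrier] hA A)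
  also have "\<dots> = A" by (simp add: k_def poly_at_mat_X[OF carrier])
  finally have kA: "poly_at_mat k A + A = A" .
  have "poly_at_mat k A = 0\<^sub>m n n"
  proof (rule eq_matI)
    fix i j assume ij: "i < dim_row (0\<^sub>m n n :: 'a mat)" "j < dim_col (0\<^sub>m n n :: 'a mat)"
    have "poly_at_mat k A $$ (i, j) + A $$ (i, j) = A $$ (i, j)"
      using arg_cong[OF kA, of "\<lambda>M. M $$ (i, j)"] ij carrier by simp
    then show "poly_at_mat k A $$ (i, j) = 0\<^sub>m n n $$ (i, j)" using ij by simp
  qed (use carrier in auto)
  then have "poly_at_mat r A = 0\<^sub>m n n"
    using poly_at_mat_dvd_diff[OF carrier cayley_hamilton[OF carrier] r(2)] by simp
  then have "r = 0" using minimal[OF r(1)] by simp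
  then show ?thesis using r(2) k_def by auto
qed

lemma coeff_0_unit_of_dvd:
  fixes P Q :: "'a::comm_ring_1 poly"
  assumes "P dvd Q" "coeff Q 0 dvd 1"
  shows "coeff P 0 dvd 1"
proof -
  obtain R where "Q = P * R" using assms(1) by (rule dvdE)
  then have "coeff Q 0 = coeff P 0 * coeff R 0" by (simp add: coeff_mult_0)
  then show ?thesis using assms(2) by (metis dvd_mult_left)
qed

theorem theorem2:
  fixes A :: "'a::finite_local_pir_length_two mat"
    and n p L :: nat
  assumes "prime p" and "odd p" and "CHAR('a residue_field) = p"
    and "L > 0" and "coprime L p"
    and "A \<in> GL n" and "compatible_cyclic A"
  shows "(\<exists>B\<in>GL n. B ^\<^sub>m L = A) \<longleftrightarrow>
    (\<forall>F. lead_coeff F = 1 \<and> fundamental_irreducible F \<and> F dvd char_poly A \<longrightarrow> L_power_poly L F)"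
proof -
  have unit: "coeff F 0 dvd 1" if "F dvd char_poly A" for F
    using coeff_0_unit_of_dvd[OF that coeff_0_char_poly_unit[OF assms(6)]] .
  note lift = lift_power_root[OF assms(1,3,5)]
  have A: "A \<in> carrier_mat n n" using assms(6) by (simp add: GL_def)
  show ?thesis
  proof
    assume "\<exists>B\<in>GL n. B ^\<^sub>m L = A"
    then obtain B where B: "B \<in> carrier_mat n n" "B ^\<^sub>m L = A"
      by (auto simp: GL_def)
    have "map_mat reduce B ^\<^sub>m L = map_mat reduce A"
      using reduce.mat_hom_pow[OF B(1), of L] B(2) by simp
    moreover have "map_mat reduce B \<in> carrier_mat n n" using B(1) by simp
    moreover have "is_minimal_poly (char_poly (map_mat reduce A)) (map_mat reduce A)"
      using assms(7) by (simp add: compatible_cyclic_def cyclic_mat_def)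
    ultimately obtain h where "char_poly (map_mat reduce A) dvd [:0, 1:] - h ^ L"
      using cyclic_power_root by blast
    then have h: "reduce_poly (char_poly A) dvd [:0, 1:] - h ^ L"
      by (simp only: reduce.char_poly_hom[OF A])
    show "\<forall>F. lead_coeff F = 1 \<and> fundamental_irreducible F \<and> F dvd char_poly A \<longrightarrow> L_power_poly L F"
    proof (intro allI impI, elim conjE)
      fix F :: "'a poly"
      assume F: "lead_coeff F = 1" "fundamental_irreducible F" "F dvd char_poly A"
      have "reduce_poly F dvd ([:0, 1:] - h ^ L) ^ 1"
        using dvd_trans[OF reduce_poly_dvd[OF F(3)] h] by simp
      from lift[OF this unit[OF F(3)]]
      show "L_power_poly L F"
        using root_imp_L_power_poly[OF F(1,2)] by blast
    qed
  next
    assume power: "\<forall>F. lead_coeff F = 1 \<and> fundamental_irreducible F \<and> F dvd char_poly A \<longrightarrow> L_power_poly L F"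
    obtain l :: nat and F r where prod: "char_poly A = (\<Prod>i<l. F i ^ r i)"
      and F: "\<forall>i<l. r i \<ge> (1 :: nat) \<and> lead_coeff (F i) = 1 \<and> fundamental_irreducible (F i)"
      and coprime: "\<forall>i<l. \<forall>j<l. i \<noteq> j \<longrightarrow> {u * F i + v * F j | u v. True} = UNIV"
      using assms(7) unfolding compatible_cyclic_def by blast
    have "\<exists>h. (\<Prod>i<l. F i ^ r i) dvd [:0, 1:] - h ^ L"
    proof (rule power_root_prod)
      fix i assume i: "i < l"
      have dvd: "F i ^ r i dvd char_poly A"
        unfolding prod using i by (intro dvd_prodI) auto
      moreover have "F i dvd F i ^ r i"
        using F i by (intro dvd_power) auto
      ultimately have "F i dvd char_poly A" by (rule dvd_trans[rotated])
      then have "L_power_poly L (F i)" using power F i by blast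
      then obtain h where "reduce_poly (F i) dvd [:0, 1:] - h ^ L"
        using L_power_poly_imp_root by blast
      then have "reduce_poly (F i ^ r i) dvd ([:0, 1:] - h ^ L) ^ r i"
        by (simp only: reduce_poly.hom_power dvd_power_same)
      then show "\<exists>h. F i ^ r i dvd [:0, 1:] - h ^ L"
        using unit[OF dvd] by (rule lift)
    next
      fix i j assume ij: "i < l" "j < l" "i \<noteq> j"
      then have "1 \<in> {u * F i + v * F j | u v. True}" using coprime by blast
      then have "comaximal (F i) (F j)" unfolding comaximal_def by force
      then show "comaximal (F i ^ r i) (F j ^ r j)"
        by (rule comaximal_power[OF comaximal_sym[OF comaximal_power[OF comaximal_sym]]])
    qed
    then obtain h where h: "char_poly A dvd [:0, 1:] - h ^ L" unfolding prod by blast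
    define B where "B = poly_at_mat h A"
    have "B ^\<^sub>m L = A"
      using poly_at_mat_dvd_diff[OF A cayley_hamilton[OF A] h]
      by (simp only: B_def poly_at_mat_power[OF A] poly_at_mat_X[OF A])
    moreover have "B \<in> GL n"
      using A assms(4,6) \<open>B ^\<^sub>m L = A\<close> by (intro GL_of_power_in_GL[of B n L]) (simp_all add: B_def)
    ultimately show "\<exists>B\<in>GL n. B ^\<^sub>m L = A" by blast
  qed
qed

end
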